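(* Let $s(n)$ denote the minimum number such that every temporal clique with $n$ vertices admits a spanner with at most $s(n)$ edges, and let $b(n)$ denote the minimum number such that every temporal bi-clique with $n$ vertices on each side admits a bi-spanner with at most $b(n)$ edges. Then $s(n) \in \Theta(b(n))$.
   Context: A temporal graph is $G=(V,E,\lambda)$ with $(V,E)$ an undirected graph and $\lambda\colon E\to\mathbb{N}$ a labeling (edge $e$ is present at time $\lambda(e)$). A path $v_1v_2\dots v_k$ in $(V,E)$ is a temporal path if $\lambda(\{v_i,v_{i+1}\})\le\lambda(\{v_{i+1},v_{i+2}\})$ for all $i\in[k-2]$ (non-strict). A vertex $u$ reaches $v$ if there is a temporal path from $u$ to $v$; $G$ is temporally connected if every vertex reaches every other vertex. A spanner of $G$ is a set $S\subseteq E$ such that $(V,S,\lambda|_S)$ is temporally connected. A temporal clique is a temporal graph whose underlying graph is complete. A temporal bi-clique $D=(A,B,\lambda)$ is a temporal graph whose underlying graph is the complete bipartite graph with disjoint parts $A,B$ (edge set $\{\{a,b\}: a\in A, b\in B\}$). A bi-spanner of $D$ is a set $S$ of edges of $D$ such that every $a\in A$ can reach every $b\in B$ via a temporal path using only edges of $S$. *)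

theory Defs
  imports Complex_Main "HOL-Library.Landau_Symbols"
begin

text \<open>A temporal graph is given by a finite vertex set, a set of two-element edges, and a labeling
  that is a total function on sets of vertices; only its values on edges matter, so the
  restriction of the labeling to a set of edges \<open>S\<close> is the same function.\<close>

definition complete_edges :: "'a set \<Rightarrow> 'a set set" where
  "complete_edges V = {{u, v} | u v. u \<in> V \<and> v \<in> V \<and> u \<noteq> v}"

definition temporal_graph :: "'a set \<Rightarrow> 'a set set \<Rightarrow> ('a set \<Rightarrow> nat) \<Rightarrow> bool" where
  "temporal_graph V E l \<longleftrightarrow> finite V \<and> E \<subseteq> complete_edges V"

definition graph_path :: "'a set \<Rightarrow> 'a set set \<Rightarrow> 'a list \<Rightarrow> bool" where
  "graph_path V E p \<longleftrightarrow> p \<noteq> [] \<and> set p \<subseteq> V \<and> distinct p \<and>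
     (\<forall>i. i + 1 < length p \<longrightarrow> {p ! i, p ! (i + 1)} \<in> E)"

definition temporal_path :: "'a set \<Rightarrow> 'a set set \<Rightarrow> ('a set \<Rightarrow> nat) \<Rightarrow> 'a list \<Rightarrow> bool" where
  "temporal_path V E l p \<longleftrightarrow> graph_path V E p \<and>
     (\<forall>i. i + 2 < length p \<longrightarrow> l {p ! i, p ! (i + 1)} \<le> l {p ! (i + 1), p ! (i + 2)})"

definition reaches :: "'a set \<Rightarrow> 'a set set \<Rightarrow> ('a set \<Rightarrow> nat) \<Rightarrow> 'a \<Rightarrow> 'a \<Rightarrow> bool" where
  "reaches V E l u v \<longleftrightarrow> (\<exists>p. temporal_path V E l p \<and> hd p = u \<and> last p = v)"

definition temporally_connected :: "'a set \<Rightarrow> 'a set set \<Rightarrow> ('a set \<Rightarrow> nat) \<Rightarrow> bool" where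
  "temporally_connected V E l \<longleftrightarrow> (\<forall>u\<in>V. \<forall>v\<in>V. u \<noteq> v \<longrightarrow> reaches V E l u v)"

definition spanner :: "'a set \<Rightarrow> 'a set set \<Rightarrow> ('a set \<Rightarrow> nat) \<Rightarrow> 'a set set \<Rightarrow> bool" where
  "spanner V E l S \<longleftrightarrow> S \<subseteq> E \<and> temporally_connected V S l"

definition temporal_clique :: "'a set \<Rightarrow> 'a set set \<Rightarrow> ('a set \<Rightarrow> nat) \<Rightarrow> bool" where
  "temporal_clique V E l \<longleftrightarrow> temporal_graph V E l \<and> E = complete_edges V"

definition temporal_biclique ::
  "'a set \<Rightarrow> 'a set \<Rightarrow> 'a set set \<Rightarrow> ('a set \<Rightarrow> nat) \<Rightarrow> bool" where
  "temporal_biclique A B E l \<longleftrightarrow>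
     temporal_graph (A \<union> B) E l \<and> A \<inter> B = {} \<and> E = {{a, b} | a b. a \<in> A \<and> b \<in> B}"

definition bi_spanner ::
  "'a set \<Rightarrow> 'a set \<Rightarrow> 'a set set \<Rightarrow> ('a set \<Rightarrow> nat) \<Rightarrow> 'a set set \<Rightarrow> bool" where
  "bi_spanner A B E l S \<longleftrightarrow> S \<subseteq> E \<and> (\<forall>a\<in>A. \<forall>b\<in>B. reaches (A \<union> B) S l a b)"

text \<open>The extremal functions range over graphs whose vertices are natural numbers. This is no
  restriction, as finite graphs can be relabeled: see \<open>clique_bound\<close> and \<open>biclique_bound\<close> below,
  which also show that the minima are attained.\<close>

definition min_spanner_size :: "nat \<Rightarrow> nat" where
  "min_spanner_size n = (LEAST k. \<forall>(V :: nat set) E l.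
     temporal_clique V E l \<and> card V = n \<longrightarrow> (\<exists>S. spanner V E l S \<and> card S \<le> k))"

definition min_bi_spanner_size :: "nat \<Rightarrow> nat" where
  "min_bi_spanner_size n = (LEAST k. \<forall>(A :: nat set) B E l.
     temporal_biclique A B E l \<and> card A = n \<and> card B = n \<longrightarrow>
       (\<exists>S. bi_spanner A B E l S \<and> card S \<le> k))"

lemma reaches_edge:
  assumes "{u, v} \<in> E" "u \<in> V" "v \<in> V" "u \<noteq> v"
  shows "reaches V E l u v"
  unfolding reaches_def
  by (rule exI[of _ "[u, v]"]) (use assms in \<open>auto simp: temporal_path_def graph_path_def\<close>)

lemma reaches_image:
  assumes g: "inj_on g V" and r: "reaches V S (\<lambda>e. l (g ` e)) u v"
  shows "reaches (g ` V) ((`) g ` S) l (g u) (g v)"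
proof -
  obtain p where p: "temporal_path V S (\<lambda>e. l (g ` e)) p" "hd p = u" "last p = v"
    using r by (auto simp: reaches_def)
  have ne: "p \<noteq> []" and sub: "set p \<subseteq> V" and d: "distinct p"
    and e: "\<And>i. i + 1 < length p \<Longrightarrow> {p ! i, p ! (i + 1)} \<in> S"
    and t: "\<And>i. i + 2 < length p \<Longrightarrow>
      l (g ` {p ! i, p ! (i + 1)}) \<le> l (g ` {p ! (i + 1), p ! (i + 2)})"
    using p(1) by (auto simp: temporal_path_def graph_path_def)
  have "{map g p ! i, map g p ! (i + 1)} \<in> (`) g ` S" if "i + 1 < length p" for i
    using imageI[OF e[OF that], of "(`) g"] that by simp
  moreover have "l {map g p ! i, map g p ! (i + 1)} \<le> l {map g p ! (i + 1), map g p ! (i + 2)}"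
    if "i + 2 < length p" for i
    using t[OF that] that by simp
  moreover have "distinct (map g p)"
    using d sub g by (simp add: distinct_map inj_on_subset)
  ultimately have "temporal_path (g ` V) ((`) g ` S) l (map g p)"
    using ne sub unfolding temporal_path_def graph_path_def by auto
  then show ?thesis
    using p ne unfolding reaches_def by (auto intro!: exI[of _ "map g p"] simp: hd_map last_map)
qed

lemma edge_card_le: "finite V \<Longrightarrow> E \<subseteq> complete_edges V \<Longrightarrow> card E \<le> 2 ^ card V"
  using card_mono[of "Pow V" E] by (force simp: complete_edges_def card_Pow)

lemma clique_bound_nat:
  assumes "temporal_clique (V :: nat set) E l" "card V = n"
  shows "\<exists>S. spanner V E l S \<and> card S \<le> min_spanner_size n"
proof -
  have "spanner V E l E \<and> card E \<le> 2 ^ n"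
    if "temporal_clique V E l" "card V = n" for V :: "nat set" and E l
    using that edge_card_le[of V E]
    by (auto simp: temporal_clique_def temporal_graph_def spanner_def temporally_connected_def
        complete_edges_def intro!: reaches_edge)
  then have "\<exists>k. \<forall>(V :: nat set) E l. temporal_clique V E l \<and> card V = n \<longrightarrow>
      (\<exists>S. spanner V E l S \<and> card S \<le> k)"
    by blast
  from LeastI_ex[OF this] show ?thesis
    using assms unfolding min_spanner_size_def by blast
qed

lemma biclique_bound_nat:
  assumes "temporal_biclique (A :: nat set) B E l" "card A = n" "card B = n"
  shows "\<exists>S. bi_spanner A B E l S \<and> card S \<le> min_bi_spanner_size n"
proof -
  have "bi_spanner A B E l E \<and> card E \<le> 2 ^ (n + n)"
    if D: "temporal_biclique A B E l" and n: "card A = n" "card B = n"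
    for A B :: "nat set" and E l
  proof
    show "bi_spanner A B E l E"
      using D by (auto simp: temporal_biclique_def bi_spanner_def intro!: reaches_edge)
    have "finite A" "finite B" "A \<inter> B = {}"
      using D by (auto simp: temporal_biclique_def temporal_graph_def)
    then have "card (A \<union> B) = n + n"
      using n by (simp add: card_Un_disjoint)
    then show "card E \<le> 2 ^ (n + n)"
      using D edge_card_le[of "A \<union> B" E]
      unfolding temporal_biclique_def temporal_graph_def by metis
  qed
  then have "\<exists>k. \<forall>(A :: nat set) B E l. temporal_biclique A B E l \<and> card A = n \<and> card B = n \<longrightarrow>
      (\<exists>S. bi_spanner A B E l S \<and> card S \<le> k)"
    by blast
  from LeastI_ex[OF this] show ?thesis
    using assms unfolding min_bi_spanner_size_def by blast
qed

lemma clique_bound: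
  assumes "temporal_clique (V :: 'a set) E l" "card V = n"
  shows "\<exists>S. spanner V E l S \<and> card S \<le> min_spanner_size n"
proof -
  have fin: "finite V" and E: "E = complete_edges V"
    using assms by (auto simp: temporal_clique_def temporal_graph_def)
  obtain g where g: "bij_betw g {0..<n} V"
    using ex_bij_betw_nat_finite[OF fin] assms(2) by blast
  then have inj: "inj_on g {0..<n}" and im: "g ` {0..<n} = V"
    by (auto simp: bij_betw_def)
  have "temporal_clique {0..<n} (complete_edges {0..<n}) (\<lambda>e. l (g ` e))"
    by (simp add: temporal_clique_def temporal_graph_def)
  from clique_bound_nat[OF this, of n] obtain S where
    S: "S \<subseteq> complete_edges {0..<n}" "temporally_connected {0..<n} S (\<lambda>e. l (g ` e))"
      "card S \<le> min_spanner_size n"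
    by (auto simp: spanner_def)
  have fS: "finite S"
    by (rule finite_subset[OF S(1)], rule finite_subset[of _ "Pow {0..<n}"])
      (auto simp: complete_edges_def)
  have "(`) g ` S \<subseteq> E"
  proof (rule image_subsetI)
    fix e assume "e \<in> S"
    then obtain i j where "e = {i, j}" "i \<in> {0..<n}" "j \<in> {0..<n}" "i \<noteq> j"
      using S(1) by (auto simp: complete_edges_def)
    then have "g ` e = {g i, g j}" "g i \<in> V" "g j \<in> V" "g i \<noteq> g j"
      using im inj_on_eq_iff[OF inj, of i j] by auto
    then show "g ` e \<in> E"
      unfolding E complete_edges_def by blast
  qed
  moreover have "reaches V ((`) g ` S) l u v" if uv: "u \<in> V" "v \<in> V" "u \<noteq> v" for u v
  proof -
    obtain i j where ij: "u = g i" "v = g j" "i \<in> {0..<n}" "j \<in> {0..<n}"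
      using uv im by blast
    have "i \<noteq> j" using uv(3) ij(1,2) by metis
    then have "reaches {0..<n} S (\<lambda>e. l (g ` e)) i j"
      using S(2) ij(3,4) by (simp add: temporally_connected_def)
    from reaches_image[OF inj this] show ?thesis
      by (simp only: im ij(1,2))
  qed
  ultimately have "spanner V E l ((`) g ` S)"
    by (auto simp: spanner_def temporally_connected_def)
  moreover have "card ((`) g ` S) \<le> min_spanner_size n"
    using card_image_le[OF fS, of "(`) g"] S(3) by simp
  ultimately show ?thesis by blast
qed

lemma biclique_bound:
  assumes D: "temporal_biclique (A :: 'a set) B E l" and n: "card A = n" "card B = n"
  shows "\<exists>S. bi_spanner A B E l S \<and> card S \<le> min_bi_spanner_size n"
proof -
  have fin: "finite (A \<union> B)" and disj: "A \<inter> B = {}" and E: "E = {{a, b} | a b. a \<in> A \<and> b \<in> B}"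
    using D by (auto simp: temporal_biclique_def temporal_graph_def)
  obtain h :: "'a \<Rightarrow> nat" where h: "inj_on h (A \<union> B)"
    using finite_imp_inj_to_nat_seg[OF fin] by blast
  define g where "g = inv_into (A \<union> B) h"
  have gh: "g (h x) = x" if "x \<in> A \<union> B" for x
    using that h by (simp add: g_def)
  define A' B' where "A' = h ` A" and "B' = h ` B"
  have inj: "inj_on g (A' \<union> B')"
    using gh unfolding A'_def B'_def by (auto simp: inj_on_def)
  have im: "g ` (A' \<union> B') = A \<union> B"
    using gh by (simp add: A'_def B'_def image_Un image_image)
  have disj': "A' \<inter> B' = {}"
    using disj h unfolding A'_def B'_def by (auto dest: inj_onD)
  define E' where "E' = {{a, b} | a b. a \<in> A' \<and> b \<in> B'}"
  have "temporal_biclique A' B' E' (\<lambda>e. l (g ` e))"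
    using disj' fin unfolding temporal_biclique_def temporal_graph_def E'_def complete_edges_def
    by (auto simp: A'_def B'_def)
  moreover have "card A' = n" "card B' = n"
    using n h by (auto simp: A'_def B'_def card_image inj_on_Un)
  ultimately have "\<exists>S. bi_spanner A' B' E' (\<lambda>e. l (g ` e)) S \<and> card S \<le> min_bi_spanner_size n"
    by (rule biclique_bound_nat)
  then obtain S where
    S: "S \<subseteq> E'" "\<forall>a\<in>A'. \<forall>b\<in>B'. reaches (A' \<union> B') S (\<lambda>e. l (g ` e)) a b"
      "card S \<le> min_bi_spanner_size n"
    unfolding bi_spanner_def by blast
  have fS: "finite S"
    by (rule finite_subset[OF S(1)], rule finite_subset[of _ "Pow (A' \<union> B')"])
      (use fin in \<open>auto simp: E'_def A'_def B'_def\<close>)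
  have "(`) g ` S \<subseteq> E"
  proof (rule image_subsetI)
    fix e assume "e \<in> S"
    then obtain a b where "e = {h a, h b}" "a \<in> A" "b \<in> B"
      using S(1) by (auto simp: E'_def A'_def B'_def)
    then show "g ` e \<in> E"
      using gh unfolding E by auto
  qed
  moreover have "reaches (A \<union> B) ((`) g ` S) l a b" if "a \<in> A" "b \<in> B" for a b
  proof -
    have "reaches (A' \<union> B') S (\<lambda>e. l (g ` e)) (h a) (h b)"
      using S(2) that by (simp add: A'_def B'_def)
    from reaches_image[OF inj this] show ?thesis
      using that by (simp add: gh im)
  qed
  ultimately have "bi_spanner A B E l ((`) g ` S)"
    by (auto simp: bi_spanner_def)
  moreover have "card ((`) g ` S) \<le> min_bi_spanner_size n"
    using card_image_le[OF fS, of "(`) g"] S(3) by simp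
  ultimately show ?thesis by blast
qed

end

theory Submission
  imports Defs
begin

text \<open>
  For \<open>s(n) \<le> b(n)\<close>, take the bipartite double cover of the clique: both sides are copies of \<open>V\<close>
  and the label of an edge is that of its projection (the label of the projected loops is
  irrelevant). Temporal paths from one side to the other project to temporal walks, so a bi-spanner
  projects to a spanner.

  For \<open>b(n) \<le> 9 s(n)\<close>, turn the bi-clique into a clique on \<open>A \<union> B\<close> by adding the edges inside \<open>B\<close>
  before and the edges inside \<open>A\<close> after all others. No temporal path from \<open>A\<close> to \<open>B\<close> can use an
  added edge. Cover each of \<open>A\<close> and \<open>B\<close> by three sets of size at most \<open>n div 2\<close>; each of the nine
  unions of a piece of \<open>A\<close> and a piece of \<open>B\<close> lies in a subclique on exactly \<open>n\<close> vertices, and the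
  spanners of these nine subcliques together contain a bi-spanner.
\<close>

section \<open>Temporal walks\<close>

text \<open>The parameter \<open>t\<close> is a lower bound for all labels on the walk.\<close>

fun twalk :: "'a set set \<Rightarrow> ('a set \<Rightarrow> nat) \<Rightarrow> nat \<Rightarrow> 'a list \<Rightarrow> bool" where
  "twalk S l t [] \<longleftrightarrow> False"
| "twalk S l t [x] \<longleftrightarrow> True"
| "twalk S l t (x # y # xs) \<longleftrightarrow> {x, y} \<in> S \<and> t \<le> l {x, y} \<and> twalk S l (l {x, y}) (y # xs)"

lemma twalk_iff_nth:
  "twalk S l t p \<longleftrightarrow> p \<noteq> [] \<and> (\<forall>i. i + 1 < length p \<longrightarrow> {p ! i, p ! (i + 1)} \<in> S) \<and>
     (\<forall>i. i + 2 < length p \<longrightarrow> l {p ! i, p ! (i + 1)} \<le> l {p ! (i + 1), p ! (i + 2)}) \<and>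
     (1 < length p \<longrightarrow> t \<le> l {p ! 0, p ! 1})"
proof (induction S l t p rule: twalk.induct)
  case (3 S l t x y xs)
  \<comment> \<open>Splitting off position 0 mirrors the recursion, whose tail already satisfies the
    indexed conditions by induction.\<close>
  have split: "(\<forall>i. P i) \<longleftrightarrow> P 0 \<and> (\<forall>i. P (Suc i))" for P :: "nat \<Rightarrow> bool"
    by (metis not0_implies_Suc)
  show ?case
    unfolding twalk.simps 3
    by (subst (3 4) split) (cases xs; auto)
qed auto

lemma reaches_iff_twalk:
  "reaches V S l u v \<longleftrightarrow>
     (\<exists>p. twalk S l 0 p \<and> set p \<subseteq> V \<and> distinct p \<and> hd p = u \<and> last p = v)"
  unfolding reaches_def temporal_path_def graph_path_def twalk_iff_nth by auto

lemma twalk_weaken: "twalk S l t p \<Longrightarrow> t' \<le> t \<Longrightarrow> twalk S l t' p"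
  by (cases "(S, l, t, p)" rule: twalk.cases) auto

lemma twalk_mono: "twalk S l t p \<Longrightarrow> S \<subseteq> S' \<Longrightarrow> twalk S' l t p"
  by (induction S l t p rule: twalk.induct) auto

text \<open>Labels never decrease along a walk, so the bound \<open>t\<close> survives dropping an
  initial piece. This permits shortcuts at repeated vertices.\<close>

lemma twalk_suffix: "twalk S l t (xs @ y # ys) \<Longrightarrow> twalk S l t (y # ys)"
proof (induction xs arbitrary: t)
  case (Cons x xs)
  then obtain z zs where z: "xs @ y # ys = z # zs" by (cases xs) auto
  with Cons.prems have "t \<le> l {x, z}" "twalk S l (l {x, z}) (xs @ y # ys)" by auto
  then show ?case using Cons.IH twalk_weaken by blast
qed simp

lemma reaches_mono: "reaches V S l u v \<Longrightarrow> V \<subseteq> V' \<Longrightarrow> S \<subseteq> S' \<Longrightarrow> reaches V' S' l u v"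
  unfolding reaches_iff_twalk by (metis order_trans twalk_mono)

section \<open>From bi-spanners to spanners\<close>

text \<open>The image of a path may repeat vertices, so \<open>q\<close> is built from the end and
  kept distinct: when \<open>f x\<close> already lies on \<open>q\<close>, the walk restarts there
  instead of being extended.\<close>

lemma twalk_project:
  assumes "twalk S (\<lambda>e. l (f ` e)) t p" "set p \<subseteq> V"
  shows "\<exists>q. twalk ((`) f ` S \<inter> complete_edges (f ` V)) l t q \<and> set q \<subseteq> f ` V \<and> distinct q \<and>
    hd q = f (hd p) \<and> last q = f (last p)"
  using assms
proof (induction S "\<lambda>e. l (f ` e)" t p rule: twalk.induct)
  case (2 S t x)
  then show ?case by (intro exI[of _ "[f x]"]) auto
next
  case (3 S t x y xs)
  let ?S = "(`) f ` S \<inter> complete_edges (f ` V)"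
  have e: "{x, y} \<in> S" "t \<le> l {f x, f y}" "x \<in> V" "y \<in> V" using 3 by auto
  obtain q where q: "twalk ?S l (l {f x, f y}) q" "set q \<subseteq> f ` V" "distinct q"
    "hd q = f y" "last q = f (last (y # xs))"
    using 3 by auto
  show ?case
  proof (cases "f x \<in> set q")
    \<comment> \<open>This case also absorbs projected loops: if \<open>f x = f y\<close>, then
      \<open>f x\<close> is the head of \<open>q\<close>.\<close>
    case True
    then obtain q1 q2 where "q = q1 @ f x # q2" by (meson split_list)
    moreover from this have "twalk ?S l t (f x # q2)"
      using q(1) e(2) twalk_suffix twalk_weaken by metis
    ultimately show ?thesis
      using q by (intro exI[of _ "f x # q2"]) auto
  next
    case False
    obtain q' where q': "q = f y # q'" using q(1,4) by (cases q) auto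
    have "{f x, f y} \<in> (`) f ` S" using imageI[OF e(1), of "(`) f"] by simp
    moreover have "{f x, f y} \<in> complete_edges (f ` V)"
      using e(3,4) False q' unfolding complete_edges_def by auto
    ultimately show ?thesis
      using q q' e False by (intro exI[of _ "f x # q"]) auto
  qed
qed auto

lemma reaches_project:
  assumes "reaches V S (\<lambda>e. l (f ` e)) u v"
  shows "reaches (f ` V) ((`) f ` S \<inter> complete_edges (f ` V)) l (f u) (f v)"
proof -
  obtain p where p: "twalk S (\<lambda>e. l (f ` e)) 0 p" "set p \<subseteq> V" "hd p = u" "last p = v"
    using assms unfolding reaches_iff_twalk by blast
  from twalk_project[OF p(1,2)] show ?thesis
    unfolding reaches_iff_twalk p(3,4) .
qed

lemma clique_spanner_from_biclique:
  assumes "temporal_clique V E l" "card V = n"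
  shows "\<exists>S. spanner V E l S \<and> card S \<le> min_bi_spanner_size n"
proof -
  have fin: "finite V" and E: "E = complete_edges V"
    using assms by (auto simp: temporal_clique_def temporal_graph_def)
  define A B where "A = V \<times> {False}" and "B = V \<times> {True}"
  define D where "D = {{a, b} | a b. a \<in> A \<and> b \<in> B}"
  have "temporal_biclique A B D (\<lambda>e. l (fst ` e))"
    using fin unfolding temporal_biclique_def temporal_graph_def complete_edges_def
    by (auto simp: A_def B_def D_def)
  moreover have "card A = n" "card B = n"
    using assms by (simp_all add: A_def B_def card_cartesian_product)
  ultimately obtain S where S: "bi_spanner A B D (\<lambda>e. l (fst ` e)) S"
    "card S \<le> min_bi_spanner_size n"
    using biclique_bound by blast
  have "finite D"
    by (rule finite_subset[of _ "Pow (A \<union> B)"]) (use fin in \<open>auto simp: A_def B_def D_def\<close>)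
  then have fS: "finite S" using S(1) finite_subset unfolding bi_spanner_def by blast
  \<comment> \<open>The intersection discards the singletons that arise from edges joining the two
    copies of one vertex.\<close>
  define T where "T = (`) fst ` S \<inter> complete_edges V"
  have V: "fst ` (A \<union> B) = V" by (force simp: A_def B_def)
  have "reaches V T l u v" if "u \<in> V" "v \<in> V" for u v
  proof -
    have "reaches (A \<union> B) S (\<lambda>e. l (fst ` e)) (u, False) (v, True)"
      using S(1) that by (simp add: bi_spanner_def A_def B_def)
    from reaches_project[OF this] show ?thesis by (simp add: V T_def)
  qed
  then have "spanner V E l T"
    by (auto simp: spanner_def temporally_connected_def T_def E)
  moreover have "card T \<le> card S"
    using card_mono[of "(`) fst ` S" T] card_image_le[OF fS, of "(`) fst"] fS
    by (auto simp: T_def)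
  ultimately show ?thesis using S(2) by (meson order_trans)
qed

lemma min_spanner_size_le: "min_spanner_size n \<le> min_bi_spanner_size n"
  unfolding min_spanner_size_def
  by (rule Least_le) (use clique_spanner_from_biclique in blast)

section \<open>From spanners to bi-spanners\<close>

text \<open>Every edge leaving \<open>A\<close> has a label below \<open>m\<close>, hence is already
  gone at time \<open>t\<close>.\<close>

lemma twalk_stays_late:
  assumes "twalk S l' t p" "set p \<subseteq> A \<union> B" "hd p \<in> A" "m \<le> t"
    and "\<And>x y. x \<in> A \<Longrightarrow> y \<in> B \<Longrightarrow> l' {x, y} < m"
  shows "last p \<in> A"
  using assms
proof (induction S l' t p rule: twalk.induct)
  case (3 S l' t x y xs)
  have "y \<in> A"
    using "3.prems"(1-4) "3.prems"(5)[of x y] by force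
  then show ?case using 3 by auto
qed auto

text \<open>An edge inside \<open>A\<close> would trap the walk in \<open>A\<close>, by
  \<open>twalk_stays_late\<close>. An edge inside \<open>B\<close> has label 0, so it is excluded
  once the bound is positive. The condition \<open>hd p \<in> A \<or> 0 < t\<close> is the
  invariant: the first crossing edge makes the bound positive. The bound \<open>t - 1\<close> undoes
  the shift by \<open>Suc\<close>.\<close>

lemma twalk_between_parts:
  assumes "twalk S l' t p" "set p \<subseteq> A \<union> B" "A \<inter> B = {}" "hd p \<in> A \<or> 0 < t" "last p \<in> B"
    and "\<And>x y. x \<in> A \<Longrightarrow> y \<in> A \<Longrightarrow> m \<le> l' {x, y}"
    and "\<And>x y. x \<in> B \<Longrightarrow> y \<in> B \<Longrightarrow> l' {x, y} = 0"
    and "\<And>x y. x \<in> A \<Longrightarrow> y \<in> B \<Longrightarrow> l' {x, y} < m"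
    and "\<And>x y. x \<in> A \<Longrightarrow> y \<in> B \<Longrightarrow> l' {x, y} = Suc (l {x, y})"
  shows "twalk (S \<inter> {{a, b} | a b. a \<in> A \<and> b \<in> B}) l (t - 1) p"
  using assms
proof (induction S l' t p rule: twalk.induct)
  case (3 S l' t x y xs)
  let ?E = "{{a, b} | a b. a \<in> A \<and> b \<in> B}"
  note prems = "3.prems"
  have w: "{x, y} \<in> S" "t \<le> l' {x, y}" "twalk S l' (l' {x, y}) (y # xs)"
    using prems(1) by auto
  have "\<not> (x \<in> A \<and> y \<in> A)"
  proof
    assume xy: "x \<in> A \<and> y \<in> A"
    then have "last (y # xs) \<in> A"
      using prems(2) by (intro twalk_stays_late[OF w(3) _ _ prems(6) prems(8)]) auto
    then show False using prems(3,5) by auto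
  qed
  moreover have "\<not> (x \<in> B \<and> y \<in> B)"
    using prems(3,4) prems(7)[of x y] w(2) by auto
  ultimately have xy: "x \<in> A \<and> y \<in> B \<or> y \<in> A \<and> x \<in> B" using prems(2) by auto
  then have lab: "l' {x, y} = Suc (l {x, y})"
    using prems(9)[of x y] prems(9)[of y x] by (auto simp: insert_commute)
  have "{x, y} \<in> ?E" using xy by (auto simp: insert_commute)
  moreover have "twalk (S \<inter> ?E) l (l' {x, y} - 1) (y # xs)"
    by (rule "3.IH"[OF w(3)]) (use prems lab in auto)
  ultimately show ?case using w lab by auto
qed auto

lemma biclique_subset_bound:
  assumes "temporal_biclique A B E l" "W \<subseteq> A \<union> B" "card W = n"
  shows "\<exists>S \<subseteq> E. card S \<le> min_spanner_size n \<and>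
    (\<forall>a \<in> A \<inter> W. \<forall>b \<in> B \<inter> W. reaches (A \<union> B) S l a b)"
proof -
  have fin: "finite A" "finite B" and disj: "A \<inter> B = {}"
    and E: "E = {{a, b} | a b. a \<in> A \<and> b \<in> B}"
    using assms(1) by (auto simp: temporal_biclique_def temporal_graph_def)
  have finE: "finite E"
    by (rule finite_subset[of _ "Pow (A \<union> B)"]) (use fin E in auto)
  \<comment> \<open>Shifted labels of crossing edges are at most \<open>sum l E + 1\<close>; the
    shift in \<open>l'\<close> reserves 0 for the edges inside \<open>B\<close>.\<close>
  define m where "m = sum l E + 2"
  define l' where "l' e = (if e \<subseteq> A then m else if e \<subseteq> B then 0 else Suc (l e))" for e
  have AB: "l' {x, y} = Suc (l {x, y})" if "x \<in> A" "y \<in> B" for x y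
    using that disj by (auto simp: l'_def)
  have late: "l' {x, y} < m" if "x \<in> A" "y \<in> B" for x y
  proof -
    have "{x, y} \<in> E" using that E by auto
    then have "l {x, y} \<le> sum l E" using finE by (simp add: member_le_sum)
    then show ?thesis using AB[OF that] by (simp add: m_def)
  qed
  have "finite W" using assms(2) fin finite_subset by blast
  then have "temporal_clique W (complete_edges W) l'"
    by (simp add: temporal_clique_def temporal_graph_def)
  then obtain T where T: "spanner W (complete_edges W) l' T" "card T \<le> min_spanner_size n"
    using clique_bound assms(3) by blast
  have "finite T"
    by (rule finite_subset[of _ "Pow W"])
      (use T(1) \<open>finite W\<close> in \<open>auto simp: spanner_def complete_edges_def\<close>)
  then have "card (T \<inter> E) \<le> min_spanner_size n"
    using T(2) card_mono[of T "T \<inter> E"] by simp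
  moreover have "reaches (A \<union> B) (T \<inter> E) l a b" if ab: "a \<in> A \<inter> W" "b \<in> B \<inter> W" for a b
  proof -
    have "a \<noteq> b" using ab disj by auto
    then have "reaches W T l' a b"
      using T(1) ab by (auto simp: spanner_def temporally_connected_def)
    then obtain p where p: "twalk T l' 0 p" "set p \<subseteq> W" "distinct p" "hd p = a" "last p = b"
      unfolding reaches_iff_twalk by blast
    \<comment> \<open>Truncated subtraction makes the new bound 0 again, as
      \<open>reaches_iff_twalk\<close> requires.\<close>
    have "twalk (T \<inter> E) l (0 - 1) p"
      unfolding E
      by (rule twalk_between_parts[OF p(1) _ disj _ _ _ _ late AB])
        (use p ab assms(2) disj in \<open>auto simp: l'_def\<close>)
    then show ?thesis
      unfolding reaches_iff_twalk using p assms(2) by auto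
  qed
  ultimately show ?thesis by blast
qed

lemma cover_by_halves:
  assumes "finite A" "2 \<le> card A"
  shows "\<exists>P. finite P \<and> card P \<le> 3 \<and> \<Union>P = A \<and> (\<forall>X\<in>P. card X \<le> card A div 2)"
proof -
  let ?h = "card A div 2"
  obtain X where X: "X \<subseteq> A" "card X = ?h"
    by (meson assms(1) obtain_subset_with_card_n div_le_dividend)
  have cX: "card (A - X) = card A - ?h"
    using X assms(1) by (simp add: card_Diff_subset finite_subset)
  moreover have "?h \<le> card A - ?h" by simp
  ultimately obtain Y where Y: "Y \<subseteq> A - X" "card Y = ?h"
    by (metis obtain_subset_with_card_n)
  have "card (A - X - Y) = card A - ?h - ?h"
    using cX Y assms(1) by (simp add: card_Diff_subset finite_subset)
  \<comment> \<open>At most one vertex remains, and the half is at least 1 because \<open>A\<close>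
    has at least two elements.\<close>
  also have "\<dots> \<le> ?h" using assms(2) by linarith
  finally have "card (A - X - Y) \<le> ?h" .
  moreover have "card {X, Y, A - X - Y} \<le> 3"
    by (simp add: card_insert_if)
  ultimately show ?thesis
    using X Y by (intro exI[of _ "{X, Y, A - X - Y}"]) auto
qed

lemma biclique_bi_spanner_from_clique:
  assumes "temporal_biclique A B E l" "card A = n" "card B = n" "2 \<le> n"
  shows "\<exists>S. bi_spanner A B E l S \<and> card S \<le> 9 * min_spanner_size n"
proof -
  have fin: "finite A" "finite B" and disj: "A \<inter> B = {}"
    using assms(1) by (auto simp: temporal_biclique_def temporal_graph_def)
  obtain P where P: "finite P" "card P \<le> 3" "\<Union>P = A" "\<forall>X\<in>P. card X \<le> n div 2"
    using cover_by_halves[OF fin(1)] assms by auto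
  obtain Q where Q: "finite Q" "card Q \<le> 3" "\<Union>Q = B" "\<forall>X\<in>Q. card X \<le> n div 2"
    using cover_by_halves[OF fin(2)] assms by auto
  have "\<exists>S \<subseteq> E. card S \<le> min_spanner_size n \<and>
      (\<forall>a\<in>X. \<forall>b\<in>Y. reaches (A \<union> B) S l a b)" if XY: "X \<in> P" "Y \<in> Q" for X Y
  proof -
    have sub: "X \<subseteq> A" "Y \<subseteq> B" using XY P(3) Q(3) by auto
    have "card (X \<union> Y) \<le> card X + card Y" by (rule card_Un_le)
    also have "\<dots> \<le> n div 2 + n div 2" using XY P(4) Q(4) by (intro add_mono) auto
    also have "\<dots> \<le> n" by simp
    finally have "card (X \<union> Y) \<le> n" .
    moreover have "n \<le> card (A \<union> B)"
      using fin assms(2) card_mono[of "A \<union> B" A] by simp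
    moreover have "X \<union> Y \<subseteq> A \<union> B" using sub by auto
    \<comment> \<open>Padding to exactly \<open>n\<close> vertices gives all nine cliques the bound
      \<open>min_spanner_size n\<close>, so values at different arguments are never
      compared.\<close>
    ultimately obtain W where W: "X \<union> Y \<subseteq> W" "W \<subseteq> A \<union> B" "card W = n"
      using exists_subset_between[of "X \<union> Y" n "A \<union> B"] fin by auto
    then have "X \<subseteq> A \<inter> W" "Y \<subseteq> B \<inter> W" using sub by auto
    then show ?thesis
      using biclique_subset_bound[OF assms(1) W(2,3)] by (meson subsetD)
  qed
  then obtain F where F: "\<And>X Y. X \<in> P \<Longrightarrow> Y \<in> Q \<Longrightarrow> F X Y \<subseteq> E \<and>
      card (F X Y) \<le> min_spanner_size n \<and> (\<forall>a\<in>X. \<forall>b\<in>Y. reaches (A \<union> B) (F X Y) l a b)"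
    by metis
  define S where "S = (\<Union>(X, Y) \<in> P \<times> Q. F X Y)"
  have "reaches (A \<union> B) S l a b" if ab: "a \<in> A" "b \<in> B" for a b
  proof -
    obtain X Y where XY: "X \<in> P" "Y \<in> Q" "a \<in> X" "b \<in> Y" using ab P(3) Q(3) by blast
    then have "F X Y \<subseteq> S" by (auto simp: S_def)
    then show ?thesis using F XY reaches_mono by (metis order_refl)
  qed
  then have "bi_spanner A B E l S"
    unfolding bi_spanner_def S_def using F by fastforce
  moreover have "card S \<le> 9 * min_spanner_size n"
  proof -
    have "card S \<le> (\<Sum>(X, Y) \<in> P \<times> Q. card (F X Y))"
      using card_UN_le[of "P \<times> Q" "\<lambda>(X, Y). F X Y"] P(1) Q(1)
      by (simp add: S_def case_prod_unfold)
    also have "\<dots> \<le> card (P \<times> Q) * min_spanner_size n"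
      using sum_bounded_above[of "P \<times> Q" "\<lambda>(X, Y). card (F X Y)" "min_spanner_size n"] F
      by auto
    also have "card (P \<times> Q) \<le> 3 * 3"
      unfolding card_cartesian_product using P(2) Q(2) by (rule mult_le_mono)
    finally show ?thesis by simp
  qed
  ultimately show ?thesis by blast
qed

text \<open>For \<open>n = 1\<close> the inequality fails: a single vertex needs no edge, whereas a
  single pair needs one.\<close>

lemma min_bi_spanner_size_le:
  assumes "2 \<le> n"
  shows "min_bi_spanner_size n \<le> 9 * min_spanner_size n"
  unfolding min_bi_spanner_size_def
  by (rule Least_le) (use biclique_bi_spanner_from_clique assms in blast)

theorem theorem3:
  "(\<lambda>n. real (min_spanner_size n)) \<in> \<Theta>(\<lambda>n. real (min_bi_spanner_size n))"
proof (rule bigthetaI)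
  show "(\<lambda>n. real (min_spanner_size n)) \<in> O(\<lambda>n. real (min_bi_spanner_size n))"
    by (rule bigoI[of _ 1]) (simp add: min_spanner_size_le)
  have "real (min_bi_spanner_size n) \<le> 9 * real (min_spanner_size n)" if "2 \<le> n" for n
    using min_bi_spanner_size_le[OF that] by linarith
  then have "(\<lambda>n. real (min_bi_spanner_size n)) \<in> O(\<lambda>n. real (min_spanner_size n))"
    by (intro bigoI[of _ 9] eventually_sequentiallyI[of 2]) simp
  then show "(\<lambda>n. real (min_spanner_size n)) \<in> \<Omega>(\<lambda>n. real (min_bi_spanner_size n))"
    by (simp add: bigomega_iff_bigo)
qed

end
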